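(* Let $\mathbf V=\sum_{k=1}^m\mathbf V_k$, where $\mathbf V_k=\sum_ac^{(k)}_{a_1,\dots,a_k}D_{a_k}\cdots D_{a_2}D_{a_1}$ is a finite linear combination of words of length $k$ in the operators $D_j$ ($j\in\mathbb{Z}$). Let $S\mathbf V_k=\sum_ac^{(k)}_{a_1,\dots,a_k}D_{a_k+1}\cdots D_{a_2+1}D_{a_1+1}$. Then $\mathbf V$ acts by zero on $\Lambda$ if and only if each of the operators $S\mathbf V_k$ ($1\le k\le m$) acts by zero on $\Lambda$.
   Context: Work over $\mathbb{Q}(q,t)$; $\Lambda$ is the algebra of symmetric functions in $X=x_1+x_2+\cdots$. Plethystic notation: $p_k[E]$ is $E$ with every variable (including $q,t$) raised to the $k$-th power; $F[E]$ substitutes $p_k\mapsto p_k[E]$ in the power-sum expansion of $F$. $\Omega[E]=\exp(\sum_{k\ge1}p_k[E]/k)$. $M=(1-t)(1-q)$. For $k\in\mathbb{Z}$, $D_kF[X]=F[X+\tfrac Mz]\Omega[-zX]|_{z^k}$ (coefficient of $z^k$). *)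

theory Defs
  imports
    "HOL-Library.Multiset"
    "HOL-Library.Poly_Mapping"
    "HOL-Computational_Algebra.Computational_Algebra"
begin

section \<open>The field of rational functions in $q$ and $t$\<close>

text \<open>The inner polynomial variable is $q$, the outer one is $t$.\<close>

type_synonym ratqt = "rat poly poly fract"

definition q_var :: ratqt where
  "q_var = Fract [:[:0, 1:]:] 1"

definition t_var :: ratqt where
  "t_var = Fract [:0, 1:] 1"


section \<open>Formal power series in countably many variables\<close>

text \<open>
  A monomial in the variables $x_0, x_1, \ldots$ is a multiset of variable indices: the multiplicity
  of \<open>i\<close> is the exponent of $x_i$, addition of multisets is multiplication of monomials, and the size
  is the total degree.
\<close>

typedef 'a mps = "UNIV :: (nat multiset \<Rightarrow> 'a) set"
  morphisms mps_coeff Abs_mps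
  by simp

setup_lifting type_definition_mps

lemma mps_eqI: "(\<And>m. mps_coeff F m = mps_coeff G m) \<Longrightarrow> F = G"
  by transfer auto

definition mono_splits :: "nat multiset \<Rightarrow> (nat multiset \<times> nat multiset) set" where
  "mono_splits m = {(a, b). a + b = m}"

lemma finite_mono_splits [simp, intro]: "finite (mono_splits m)"
proof (induction m)
  case empty
  have "mono_splits {#} \<subseteq> {({#}, {#})}"
    by (auto simp: mono_splits_def)
  then show ?case
    using finite_subset by blast
next
  case (add x m)
  have "mono_splits (add_mset x m) \<subseteq>
      (\<lambda>(a, b). (add_mset x a, b)) ` mono_splits m \<union> (\<lambda>(a, b). (a, add_mset x b)) ` mono_splits m"
  proof (rule subsetI)
    fix p assume "p \<in> mono_splits (add_mset x m)"
    then obtain a b where p: "p = (a, b)" and ab: "a + b = add_mset x m"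
      by (auto simp: mono_splits_def)
    have "x \<in># a + b"
      using ab by simp
    then consider a' where "a = add_mset x a'" | b' where "b = add_mset x b'"
      by (auto dest: multi_member_split)
    then show "p \<in> (\<lambda>(a, b). (add_mset x a, b)) ` mono_splits m \<union>
        (\<lambda>(a, b). (a, add_mset x b)) ` mono_splits m"
      by cases (use ab p in \<open>auto simp: mono_splits_def image_iff\<close>)
  qed
  then show ?case
    using add.IH by (meson finite_UnI finite_imageI finite_subset)
qed

instantiation mps :: (comm_ring_1) comm_ring_1
begin

lift_definition zero_mps :: "'a mps" is "\<lambda>_. 0" .

lift_definition one_mps :: "'a mps" is "\<lambda>m. if m = {#} then 1 else 0" .

lift_definition plus_mps :: "'a mps \<Rightarrow> 'a mps \<Rightarrow> 'a mps" is "\<lambda>F G m. F m + G m" .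

lift_definition minus_mps :: "'a mps \<Rightarrow> 'a mps \<Rightarrow> 'a mps" is "\<lambda>F G m. F m - G m" .

lift_definition uminus_mps :: "'a mps \<Rightarrow> 'a mps" is "\<lambda>F m. - F m" .

lift_definition times_mps :: "'a mps \<Rightarrow> 'a mps \<Rightarrow> 'a mps"
  is "\<lambda>F G m. \<Sum>(a, b)\<in>mono_splits m. F a * G b" .

instance
proof
  fix F G H :: "'a mps"
  show "F + G + H = F + (G + H)" "F + G = G + F" "0 + F = F" "- F + F = 0" "F - G = F + - G"
    by (transfer; simp add: algebra_simps)+
  show "F * G = G * F"
  proof transfer
    fix F G :: "nat multiset \<Rightarrow> 'a"
    show "(\<lambda>m. \<Sum>(a, b)\<in>mono_splits m. F a * G b) = (\<lambda>m. \<Sum>(a, b)\<in>mono_splits m. G a * F b)"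
      by (rule ext, rule sum.reindex_bij_witness[of _ prod.swap prod.swap])
        (auto simp: mono_splits_def ac_simps)
  qed
  show "(F + G) * H = F * H + G * H"
    by transfer (auto simp: algebra_simps case_prod_unfold sum.distrib)
  show "1 * F = F"
  proof transfer
    fix F :: "nat multiset \<Rightarrow> 'a"
    show "(\<lambda>m. \<Sum>(a, b)\<in>mono_splits m. (if a = {#} then 1 else 0) * F b) = F"
    proof
      fix m
      have "(\<Sum>(a, b)\<in>mono_splits m. (if a = {#} then 1 else 0) * F b) =
          (\<Sum>(a, b)\<in>{({#} :: nat multiset, m)}. (if a = {#} then 1 else 0) * F b)"
        by (rule sum.mono_neutral_right[OF finite_mono_splits])
          (auto simp: mono_splits_def split: if_splits)
      then show "(\<Sum>(a, b)\<in>mono_splits m. (if a = {#} then 1 else 0) * F b) = F m"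
        by simp
    qed
  qed
  show "F * G * H = F * (G * H)"
  proof transfer
    fix F G H :: "nat multiset \<Rightarrow> 'a"
    show "(\<lambda>m. \<Sum>(a, b)\<in>mono_splits m. (\<Sum>(c, d)\<in>mono_splits a. F c * G d) * H b) =
        (\<lambda>m. \<Sum>(a, b)\<in>mono_splits m. F a * (\<Sum>(c, d)\<in>mono_splits b. G c * H d))"
    proof
      fix m
      have "(\<Sum>(a, b)\<in>mono_splits m. (\<Sum>(c, d)\<in>mono_splits a. F c * G d) * H b) =
          (\<Sum>(p, r)\<in>(SIGMA p:mono_splits m. mono_splits (fst p)). F (fst r) * G (snd r) * H (snd p))"
        by (subst sum.Sigma[symmetric]) (simp_all add: case_prod_unfold sum_distrib_right)
      also have "\<dots> =
          (\<Sum>(p, r)\<in>(SIGMA p:mono_splits m. mono_splits (snd p)). F (fst p) * (G (fst r) * H (snd r)))"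
        by (rule sum.reindex_bij_witness
            [of _ "\<lambda>((a, b), (c, d)). ((a + c, d), (a, c))" "\<lambda>((a, b), (c, d)). ((c, d + b), (d, b))"])
          (auto simp: mono_splits_def ac_simps)
      also have "\<dots> = (\<Sum>(a, b)\<in>mono_splits m. F a * (\<Sum>(c, d)\<in>mono_splits b. G c * H d))"
        by (subst sum.Sigma[symmetric]) (simp_all add: case_prod_unfold sum_distrib_left)
      finally show "(\<Sum>(a, b)\<in>mono_splits m. (\<Sum>(c, d)\<in>mono_splits a. F c * G d) * H b) =
          (\<Sum>(a, b)\<in>mono_splits m. F a * (\<Sum>(c, d)\<in>mono_splits b. G c * H d))" .
    qed
  qed
  show "(0 :: 'a mps) \<noteq> 1"
  proof
    assume "(0 :: 'a mps) = 1"
    then have "mps_coeff (0 :: 'a mps) {#} = mps_coeff 1 {#}"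
      by simp
    then show False
      by (simp add: zero_mps.rep_eq one_mps.rep_eq)
  qed
qed

end

lift_definition mps_const :: "'a \<Rightarrow> 'a::zero mps" is "\<lambda>c m. if m = {#} then c else 0" .


section \<open>Symmetric functions\<close>

definition Lam :: "ratqt mps set" where
  "Lam = {F. (\<forall>\<pi> m. bij \<pi> \<longrightarrow> mps_coeff F (image_mset \<pi> m) = mps_coeff F m) \<and>
             (\<exists>d. \<forall>m. size m > d \<longrightarrow> mps_coeff F m = 0)}"

text \<open>The power sum $p_k = p_k[X] = \sum_i x_i^k$, used for $k \geq 1$ only.\<close>

definition psum :: "nat \<Rightarrow> ratqt mps" where
  "psum k = Abs_mps (\<lambda>m. if \<exists>i. m = replicate_mset k i then 1 else 0)"

text \<open>
  The expansion $F = \sum_\mu c_\mu p_\mu$ in the products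
  $p_\mu = p_{\mu_1} p_{\mu_2} \cdots$ for integer partitions $\mu$, which are
  represented as multisets of positive parts.  It exists uniquely for symmetric functions \<open>F\<close>.
\<close>

definition is_psum_expansion :: "(nat multiset \<Rightarrow>\<^sub>0 ratqt) \<Rightarrow> ratqt mps \<Rightarrow> bool" where
  "is_psum_expansion c F \<longleftrightarrow>
     (\<forall>\<mu>\<in>Poly_Mapping.keys c. 0 \<notin># \<mu>) \<and>
     F = (\<Sum>\<mu>\<in>Poly_Mapping.keys c. mps_const (Poly_Mapping.lookup c \<mu>) * (\<Prod>r\<in>#\<mu>. psum r))"

definition psum_expansion :: "ratqt mps \<Rightarrow> (nat multiset \<Rightarrow>\<^sub>0 ratqt)" where
  "psum_expansion F = (THE c. is_psum_expansion c F)"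


section \<open>Plethystic substitution and the operators $D_k$\<close>

text \<open>
  Plethystic alphabets \<open>E\<close> enter only through the family \<open>P k\<close> $= p_k[E]$.  The ambient ring is that of
  Laurent series in $z$ whose coefficients are power series in the $x_i$.
\<close>

definition plethysm :: "ratqt mps \<Rightarrow> (nat \<Rightarrow> ratqt mps fls) \<Rightarrow> ratqt mps fls" where
  "plethysm F P =
     (\<Sum>\<mu>\<in>Poly_Mapping.keys (psum_expansion F).
        fls_const (mps_const (Poly_Mapping.lookup (psum_expansion F) \<mu>)) * (\<Prod>r\<in>#\<mu>. P r))"

text \<open>$p_k[M]$ for $M = (1 - t)(1 - q)$\<close>

definition p_M :: "nat \<Rightarrow> ratqt" where
  "p_M k = (1 - t_var ^ k) * (1 - q_var ^ k)"

text \<open>$p_k[X + M/z] = p_k[X] + p_k[M] z^{-k}$\<close>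

definition p_X_plus_M_over_z :: "nat \<Rightarrow> ratqt mps fls" where
  "p_X_plus_M_over_z k = fls_const (psum k) + fls_const (mps_const (p_M k)) * fls_X_inv ^ k"

text \<open>
  $\Omega[zA] = \exp(\sum_{k \geq 1} p_k[A] z^k / k)$ as a power series in $z$, where \<open>P k\<close> $= p_k[A]$;
  the left operand of the composition is the exponential series.
\<close>

definition Omega_z :: "(nat \<Rightarrow> ratqt mps) \<Rightarrow> ratqt mps fps" where
  "Omega_z P =
     Abs_fps (\<lambda>n. mps_const (1 / of_nat (fact n))) oo
     Abs_fps (\<lambda>k. if k = 0 then 0 else mps_const (1 / of_nat k) * P k)"

text \<open>The plethystic minus sign is $p_k[-X] = - p_k[X]$ for every \<open>k\<close>.\<close>

definition D_op :: "int \<Rightarrow> ratqt mps \<Rightarrow> ratqt mps" where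
  "D_op k F =
     fls_nth (plethysm F p_X_plus_M_over_z * fps_to_fls (Omega_z (\<lambda>k. - psum k))) k"

text \<open>
  The word $D_{a_k} \cdots D_{a_2} D_{a_1}$ is indexed by the list $[a_1, \ldots, a_k]$, so that the
  head of the list acts first.
\<close>

definition D_word :: "int list \<Rightarrow> ratqt mps \<Rightarrow> ratqt mps" where
  "D_word a = fold D_op a"

definition word_op :: "(int list \<Rightarrow>\<^sub>0 ratqt) \<Rightarrow> ratqt mps \<Rightarrow> ratqt mps" where
  "word_op c F = (\<Sum>a\<in>Poly_Mapping.keys c. mps_const (Poly_Mapping.lookup c a) * D_word a F)"

definition shifted_word_op :: "(int list \<Rightarrow>\<^sub>0 ratqt) \<Rightarrow> ratqt mps \<Rightarrow> ratqt mps" where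
  "shifted_word_op c F =
     (\<Sum>a\<in>Poly_Mapping.keys c. mps_const (Poly_Mapping.lookup c a) * D_word (map (\<lambda>j. j + 1) a) F)"

end

theory Submission
  imports Defs "HOL-Combinatorics.Permutations"
begin

text \<open>
  Multiplication by $p_r$ and the derivation $\partial_r = \partial/\partial p_r$ satisfy
  $[D_k, p_r] = p_r[M]\, D_{k+r}$ and $[D_k, \partial_r] = \frac1r D_{k-r}$.  If $z_i$ denotes the shift
  of the \<open>i\<close>-th index of a word, commuting a combination of words with these operators thus multiplies
  it, up to a nonzero scalar, by $p_r(z)$ or $p_r(z^{-1})$.  Hence the combinations that act by zero
  on $\Lambda$ are stable under $p_r(z^{\pm1})$, and by Newton's identities under $e_j(z^{\pm1})$.  On
  words of length \<open>k\<close>, $e_k(z)$ is the shift \<open>S\<close>, $e_k(z^{-1})$ is its inverse, and $e_j$ vanishes for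
  $j > k$; so $e_m(z)$ isolates $S \mathbf{V}_m$, and one concludes by descending induction on the length.
\<close>

text \<open>Characteristic zero of the scalars allows division by positive integers in \<Omega> and
  in Newton's identities, and keeps positive integer coefficients nonzero.\<close>

instance fract :: ("{idom, ring_char_0}") field_char_0
proof
  show "inj (of_nat :: nat \<Rightarrow> 'a fract)"
    by (rule injI) (simp add: of_nat_fract eq_fract)
qed

section \<open>Coefficients and scalars of power series\<close>

lemma mps_coeff_zero [simp]: "mps_coeff 0 m = 0"
  by (simp add: zero_mps.rep_eq)

lemma mps_coeff_one: "mps_coeff 1 m = (if m = {#} then 1 else 0)"
  by (simp add: one_mps.rep_eq)

lemma mps_coeff_add [simp]: "mps_coeff (F + G) m = mps_coeff F m + mps_coeff G m"
  by (simp add: plus_mps.rep_eq)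

lemma mps_coeff_diff [simp]: "mps_coeff (F - G) m = mps_coeff F m - mps_coeff G m"
  by (simp add: minus_mps.rep_eq)

lemma mps_coeff_mult:
  "mps_coeff (F * G) m = (\<Sum>(a, b)\<in>mono_splits m. mps_coeff F a * mps_coeff G b)"
  by (simp add: times_mps.rep_eq)

lemma mps_coeff_sum: "mps_coeff (\<Sum>x\<in>A. f x) m = (\<Sum>x\<in>A. mps_coeff (f x) m)"
  by (induction A rule: infinite_finite_induct) simp_all

lemma mps_const_0 [simp]: "mps_const 0 = 0"
  by (rule mps_eqI) (simp add: mps_const.rep_eq)

lemma mps_const_1 [simp]: "mps_const 1 = 1"
  by (rule mps_eqI) (simp add: mps_const.rep_eq mps_coeff_one)

lemma mps_const_add: "mps_const (a + b) = mps_const a + mps_const (b :: 'a :: comm_ring_1)"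
  by (rule mps_eqI) (simp add: mps_const.rep_eq)

lemma mps_coeff_const_mult [simp]:
  "mps_coeff (mps_const c * F) m = c * mps_coeff (F :: 'a :: comm_ring_1 mps) m"
proof -
  have "mps_coeff (mps_const c * F) m =
      (\<Sum>(a, b)\<in>{({#} :: nat multiset, m)}. mps_coeff (mps_const c) a * mps_coeff F b)"
    unfolding mps_coeff_mult
    by (rule sum.mono_neutral_right[OF finite_mono_splits])
      (auto simp: mono_splits_def mps_const.rep_eq split: if_splits)
  then show ?thesis
    by (simp add: mps_const.rep_eq)
qed

lemma mps_const_mult: "mps_const (a * b) = mps_const a * mps_const (b :: 'a :: comm_ring_1)"
  by (rule mps_eqI) (simp add: mps_const.rep_eq)

lemma mps_const_uminus: "mps_const (- a) = - mps_const (a :: 'a :: comm_ring_1)"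
  by (metis add.right_inverse mps_const_0 mps_const_add neg_eq_iff_add_eq_0)

lemma mps_const_of_nat: "mps_const (of_nat n) = (of_nat n :: 'a :: comm_ring_1 mps)"
  by (induction n) (simp_all add: mps_const_add)

lemma mps_const_mult_eq_0D:
  assumes "mps_const c * F = 0" "c \<noteq> (0 :: 'a :: field)"
  shows "F = 0"
proof -
  have "mps_const (inverse c) * (mps_const c * F) = F"
    using assms(2) by (simp flip: mps_const_mult mult.assoc)
  then show ?thesis
    using assms(1) by simp
qed

section \<open>The algebra of symmetric functions\<close>

lemma Lam_coeff_image_mset: "F \<in> Lam \<Longrightarrow> bij \<pi> \<Longrightarrow> mps_coeff F (image_mset \<pi> m) = mps_coeff F m"
  by (simp add: Lam_def)

lemma Lam_degreeE:
  assumes "F \<in> Lam"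
  obtains d where "\<And>m. size m > d \<Longrightarrow> mps_coeff F m = 0"
  using assms by (auto simp: Lam_def)

lemma Lam_0 [simp, intro]: "0 \<in> Lam"
  by (auto simp: Lam_def)

lemma Lam_1 [simp, intro]: "1 \<in> Lam"
  by (auto simp: Lam_def mps_coeff_one intro!: exI[of _ 0])

lemma Lam_const_mult [simp, intro]: "F \<in> Lam \<Longrightarrow> mps_const c * F \<in> Lam"
  by (auto simp: Lam_def)

lemma Lam_add [simp, intro]:
  assumes "F \<in> Lam" "G \<in> Lam"
  shows "F + G \<in> Lam"
proof -
  obtain d e where "\<And>m. size m > d \<Longrightarrow> mps_coeff F m = 0" "\<And>m. size m > e \<Longrightarrow> mps_coeff G m = 0"
    using assms by (meson Lam_degreeE)
  then have "\<exists>d. \<forall>m. size m > d \<longrightarrow> mps_coeff F m + mps_coeff G m = 0"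
    by (intro exI[of _ "max d e"]) simp
  then show ?thesis
    using assms by (simp add: Lam_def)
qed

lemma Lam_sum [intro]: "(\<And>x. x \<in> A \<Longrightarrow> f x \<in> Lam) \<Longrightarrow> (\<Sum>x\<in>A. f x) \<in> Lam"
  by (induction A rule: infinite_finite_induct) auto

lemma Lam_uminus [simp, intro]: "F \<in> Lam \<Longrightarrow> - F \<in> Lam"
  using Lam_const_mult[of F "-1"] by (simp add: mps_const_uminus)

lemma Lam_diff [simp, intro]: "F \<in> Lam \<Longrightarrow> G \<in> Lam \<Longrightarrow> F - G \<in> Lam"
  using Lam_add[of F "- G"] by simp

lemma Lam_mult [simp, intro]:
  assumes "F \<in> Lam" "G \<in> Lam"
  shows "F * G \<in> Lam"
proof -
  obtain d e where d: "\<And>m. size m > d \<Longrightarrow> mps_coeff F m = 0"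
    and e: "\<And>m. size m > e \<Longrightarrow> mps_coeff G m = 0"
    using assms by (meson Lam_degreeE)
  have "mps_coeff (F * G) m = 0" if "size m > d + e" for m
    unfolding mps_coeff_mult
  proof (rule sum.neutral, clarify)
    fix a b assume "(a, b) \<in> mono_splits m"
    then have "size a > d \<or> size b > e"
      using that by (auto simp: mono_splits_def)
    then show "mps_coeff F a * mps_coeff G b = 0"
      using d e by auto
  qed
  moreover have "mps_coeff (F * G) (image_mset \<pi> m) = mps_coeff (F * G) m" if "bij \<pi>" for \<pi> m
  proof -
    have inv: "image_mset (inv \<pi>) (image_mset \<pi> a) = a" "image_mset \<pi> (image_mset (inv \<pi>) a) = a" for a
      using that by (simp_all add: multiset.map_comp bij_is_inj bij_is_surj surj_iff[THEN iffD1])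
    show ?thesis
      unfolding mps_coeff_mult
      by (rule sum.reindex_bij_witness[of _ "\<lambda>(a, b). (image_mset \<pi> a, image_mset \<pi> b)"
            "\<lambda>(a, b). (image_mset (inv \<pi>) a, image_mset (inv \<pi>) b)"])
        (use that in \<open>auto simp: mono_splits_def inv Lam_coeff_image_mset[OF assms(1)] Lam_coeff_image_mset[OF assms(2)]
            bij_imp_bij_inv simp flip: image_mset_union\<close>)
  qed
  ultimately show ?thesis
    by (auto simp: Lam_def)
qed

lemma mps_coeff_psum:
  "mps_coeff (psum k) m = (if \<exists>i. m = replicate_mset k i then 1 else 0)"
  by (simp add: psum_def Abs_mps_inverse)

lemma Lam_psum [simp, intro]: "psum k \<in> Lam"
proof -
  have "(\<exists>i. image_mset \<pi> m = replicate_mset k i) \<longleftrightarrow> (\<exists>i. m = replicate_mset k i)"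
    if "bij \<pi>" for \<pi> :: "nat \<Rightarrow> nat" and m
  proof
    assume "\<exists>i. image_mset \<pi> m = replicate_mset k i"
    then obtain i where "image_mset (inv \<pi>) (image_mset \<pi> m) = image_mset (inv \<pi>) (replicate_mset k i)"
      by auto
    then show "\<exists>i. m = replicate_mset k i"
      using that by (auto simp: multiset.map_comp bij_is_inj)
  qed auto
  moreover have "mps_coeff (psum k) m = 0" if "size m > k" for m
    using that by (auto simp: mps_coeff_psum)
  ultimately show ?thesis
    by (auto simp: Lam_def mps_coeff_psum)
qed

abbreviation psum_prod :: "nat multiset \<Rightarrow> ratqt mps" where
  "psum_prod \<mu> \<equiv> (\<Prod>r\<in>#\<mu>. psum r)"

lemma Lam_psum_prod [simp, intro]: "psum_prod \<mu> \<in> Lam"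
  by (induction \<mu>) auto

section \<open>The power sum basis\<close>

text \<open>The exponent partition of a monomial. Only variables that occur are counted, so 0 is
  never a part; two monomials share it exactly when a permutation of the variables takes one to the
  other.\<close>

definition exponents :: "nat multiset \<Rightarrow> nat multiset" where
  "exponents m = image_mset (count m) (mset_set (set_mset m))"

lemma size_exponents [simp]: "size (exponents m) = card (set_mset m)"
  by (simp add: exponents_def)

lemma zero_notin_exponents [simp]: "0 \<notin># exponents m"
  by (auto simp: exponents_def simp flip: count_greater_zero_iff)

lemma sum_mset_exponents [simp]: "\<Sum>\<^sub># (exponents m) = size m"
  by (simp add: exponents_def size_multiset_overloaded_eq sum_unfold_sum_mset)

lemma exponents_replicate_add:
  assumes "i \<notin># b" "r > 0"
  shows "exponents (replicate_mset r i + b) = add_mset r (exponents b)"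
proof -
  have "image_mset (count (replicate_mset r i + b)) (mset_set (set_mset b)) =
      image_mset (count b) (mset_set (set_mset b))"
    using assms by (intro image_mset_cong) auto
  then show ?thesis
    using assms by (simp add: exponents_def count_eq_zero_iff del: count_union) 
      (simp add: count_eq_zero_iff)
qed

text \<open>A fresh variable raised to the power \<open>r\<close> realises each further part
  \<open>r\<close>.\<close>

lemma exponents_surj:
  assumes "0 \<notin># \<mu>"
  shows "\<exists>m. exponents m = \<mu>"
  using assms
proof (induction \<mu>)
  case empty
  show ?case
    by (rule exI[of _ "{#}"]) (simp add: exponents_def)
next
  case (add r \<mu>)
  then obtain b where b: "exponents b = \<mu>"
    by auto
  obtain i where "i \<notin># b"
    using ex_new_if_finite[OF infinite_UNIV_nat finite_set_mset[of b]] by blast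
  then show ?case
    using exponents_replicate_add[of i b r] add.prems b by auto
qed

text \<open>On the union of both supports, padding with zero exponents makes the two exponent
  functions take the same multiset of values. This yields a permutation of that finite union, fixing
  all other indices.\<close>

lemma exponents_eq_imp_permutation:
  assumes "exponents m = exponents m'"
  obtains \<pi> where "bij \<pi>" "m' = image_mset \<pi> m"
proof -
  define A where "A = set_mset m \<union> set_mset m'"
  have decomp: "image_mset (count n) (mset_set A) =
      exponents n + replicate_mset (card A - card (set_mset n)) 0" if "set_mset n \<subseteq> A" for n
  proof -
    have fin: "finite A"
      by (simp add: A_def)
    have "mset_set A = mset_set (set_mset n) + mset_set (A - set_mset n)"
      using that fin by (subst mset_set_Union[symmetric]) (auto simp: Un_absorb1)
    moreover have "image_mset (count n) (mset_set (A - set_mset n)) =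
        image_mset (\<lambda>_. 0) (mset_set (A - set_mset n))"
      using fin by (intro image_mset_cong) (auto simp: count_eq_zero_iff)
    ultimately show ?thesis
      using that fin by (simp add: exponents_def image_mset_const_eq card_Diff_subset)
  qed
  have "card (set_mset m) = card (set_mset m')"
    using assms by (metis size_exponents)
  then have "image_mset (count m) (mset_set A) = image_mset (count m') (mset_set A)"
    using assms decomp[of m] decomp[of m'] by (auto simp: A_def)
  then obtain p where p: "p permutes A" "\<forall>x\<in>A. count m x = count m' (p x)"
    using image_mset_eq_implies_permutes[of A "count m" "count m'"] by (auto simp: A_def)
  have eq: "count m x = count m' (p x)" for x
  proof (cases "x \<in> A")
    case False
    then show ?thesis
      using permutes_not_in[OF p(1)] by (simp add: A_def not_in_iff)
  qed (use p in auto)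
  have "bij p"
    using p(1) permutes_bij by blast
  have "m' = image_mset p m"
  proof (rule multiset_eqI)
    fix y
    obtain x where y: "y = p x"
      using \<open>bij p\<close> by (metis bij_pointE)
    have "count (image_mset p m) (p x) = count m x"
      using bij_is_inj[OF \<open>bij p\<close>] by (induction m) (auto simp: inj_eq)
    then show "count m' y = count (image_mset p m) y"
      using eq y by simp
  qed
  with \<open>bij p\<close> show ?thesis
    by (rule that)
qed

lemma Lam_coeff_exponents_cong:
  "F \<in> Lam \<Longrightarrow> exponents m = exponents m' \<Longrightarrow> mps_coeff F m = mps_coeff F m'"
  by (metis exponents_eq_imp_permutation Lam_coeff_image_mset)

text \<open>
  Triangularity: the monomials of $p_\mu$ arise from $\mu$ by merging parts, so a monomial of $p_\mu$
  with as many variables as $\mu$ has parts has exponents exactly $\mu$.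
\<close>

lemma psum_prod_coeff_nonzero:
  assumes "mps_coeff (psum_prod \<mu>) m \<noteq> 0" "0 \<notin># \<mu>"
  shows "card (set_mset m) \<le> size \<mu> \<and> (card (set_mset m) = size \<mu> \<longrightarrow> exponents m = \<mu>)"
  using assms
proof (induction \<mu> arbitrary: m)
  case empty
  then show ?case
    by (auto simp: mps_coeff_one exponents_def split: if_splits)
next
  case (add r \<mu>)
  have "(\<Sum>(a, b)\<in>mono_splits m. mps_coeff (psum r) a * mps_coeff (psum_prod \<mu>) b) \<noteq> 0"
    using add.prems by (simp add: mps_coeff_mult)
  then obtain p where "p \<in> mono_splits m"
    "(case p of (a, b) \<Rightarrow> mps_coeff (psum r) a * mps_coeff (psum_prod \<mu>) b) \<noteq> 0"
    by (rule sum.not_neutral_contains_not_neutral)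
  then obtain a b where ab: "a + b = m" "mps_coeff (psum r) a * mps_coeff (psum_prod \<mu>) b \<noteq> 0"
    by (auto simp: mono_splits_def)
  then obtain i where i: "a = replicate_mset r i"
    by (auto simp: mps_coeff_psum split: if_splits)
  have r: "r > 0"
    using add.prems by auto
  have IH: "card (set_mset b) \<le> size \<mu>" "card (set_mset b) = size \<mu> \<Longrightarrow> exponents b = \<mu>"
    using add.IH[of b] add.prems ab by auto
  \<comment> \<open>If \<open>i\<close> already occurs in \<open>b\<close>, the part
    \<open>r\<close> merges with another one and no variable is gained, so there are strictly fewer
    variables than parts.\<close>
  have card: "card (set_mset m) = (if i \<in># b then card (set_mset b) else Suc (card (set_mset b)))"
    using ab(1) i r by (auto simp: insert_absorb)
  show ?case
    using IH card ab(1) i exponents_replicate_add[of i b r] r by (auto split: if_splits)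
qed

text \<open>The coefficients count the ways to pick one variable per factor. Nonnegativity rules out
  cancellation in the diagonal coefficients.\<close>

lemma psum_prod_coeff_nat: "\<exists>n. mps_coeff (psum_prod \<mu>) m = of_nat n"
proof (induction \<mu> arbitrary: m)
  case empty
  show ?case
    by (auto simp: mps_coeff_one intro: exI[of _ 0] exI[of _ 1])
next
  case (add r \<mu>)
  then obtain n where n: "\<And>m. mps_coeff (psum_prod \<mu>) m = of_nat (n m)"
    by metis
  have "mps_coeff (psum_prod (add_mset r \<mu>)) m =
      of_nat (\<Sum>(a, b)\<in>mono_splits m. (if \<exists>i. a = replicate_mset r i then 1 else 0) * n b)"
    by (simp add: mps_coeff_mult mps_coeff_psum n case_prod_unfold)
      (auto intro!: sum.cong)
  then show ?case
    by blast
qed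

text \<open>Assigning each part to a variable with that exponent is one way to produce the monomial.
  All contributions are natural numbers, so the total is positive.\<close>

lemma psum_prod_coeff_exponents:
  assumes "exponents m = \<mu>"
  shows "mps_coeff (psum_prod \<mu>) m \<noteq> 0"
  using assms
proof (induction \<mu> arbitrary: m)
  case empty
  then have "set_mset m = {}"
    by (metis size_exponents size_empty card_eq_0_iff finite_set_mset)
  then show ?case
    by (simp add: mps_coeff_one)
next
  case (add r \<mu>)
  have "r \<in># exponents m"
    using add.prems by simp
  then obtain i where i: "i \<in># m" "r = count m i"
    by (auto simp: exponents_def)
  \<comment> \<open>All powers of \<open>i\<close> are removed at once, so that exactly the part
    \<open>r\<close> is split off.\<close>
  define b where "b = filter_mset (\<lambda>j. j \<noteq> i) m"
  have m: "m = replicate_mset r i + b"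
    by (rule multiset_eqI) (auto simp: b_def i)
  have "exponents m = add_mset r (exponents b)"
    unfolding m using i by (intro exponents_replicate_add) (auto simp: b_def)
  then have b: "mps_coeff (psum_prod \<mu>) b \<noteq> 0"
    using add by simp
  obtain n where n: "\<And>m. mps_coeff (psum_prod \<mu>) m = of_nat (n m)"
    using psum_prod_coeff_nat by metis
  let ?f = "\<lambda>(a, b). (if \<exists>i. a = replicate_mset r i then 1 else 0) * n b"
  have "?f (replicate_mset r i, b) \<le> (\<Sum>p\<in>mono_splits m. ?f p)"
    by (rule member_le_sum[OF _ _ finite_mono_splits]) (auto simp: mono_splits_def m)
  moreover have "?f (replicate_mset r i, b) > 0"
    using b n by auto
  ultimately have "(\<Sum>p\<in>mono_splits m. ?f p) \<noteq> 0"
    by linarith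
  moreover have "mps_coeff (psum_prod (add_mset r \<mu>)) m = of_nat (\<Sum>p\<in>mono_splits m. ?f p)"
    by (simp add: mps_coeff_mult mps_coeff_psum n case_prod_unfold)
      (auto intro!: sum.cong)
  ultimately show ?case
    by (simp only: of_nat_eq_0_iff not_False_eq_True)
qed

section \<open>Linear extension and linear independence of power sum products\<close>

definition linear_extension ::
  "(ratqt \<Rightarrow> 'b) \<Rightarrow> (nat multiset \<Rightarrow> 'b) \<Rightarrow> (nat multiset \<Rightarrow>\<^sub>0 ratqt) \<Rightarrow> 'b :: comm_ring_1" where
  "linear_extension \<iota> G c =
     (\<Sum>\<mu>\<in>Poly_Mapping.keys c. \<iota> (Poly_Mapping.lookup c \<mu>) * G \<mu>)"

abbreviation psum_eval :: "(nat multiset \<Rightarrow>\<^sub>0 ratqt) \<Rightarrow> ratqt mps" where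
  "psum_eval \<equiv> linear_extension mps_const psum_prod"

lemma is_psum_expansion_iff:
  "is_psum_expansion c F \<longleftrightarrow> (\<forall>\<mu>\<in>Poly_Mapping.keys c. 0 \<notin># \<mu>) \<and> F = psum_eval c"
  by (simp add: is_psum_expansion_def linear_extension_def)

text \<open>The target ring is kept general: evaluation and \<partial>/\<partial>p_r take values in
  \<open>mps\<close>, plethysm in Laurent series over it.\<close>

locale scalar_embedding =
  fixes \<iota> :: "ratqt \<Rightarrow> 'b :: comm_ring_1"
  assumes add: "\<iota> (x + y) = \<iota> x + \<iota> y"
    and mult: "\<iota> (x * y) = \<iota> x * \<iota> y"
    and one: "\<iota> 1 = 1"
begin

lemma zero: "\<iota> 0 = 0"
  using add[of 0 0] by simp

lemma linear_extension_add:
  "linear_extension \<iota> G (c + d) = linear_extension \<iota> G c + linear_extension \<iota> G d"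
  unfolding linear_extension_def
  by (rule setsum_keys_plus_distrib) (simp_all add: zero add distrib_right)

lemma linear_extension_single: "linear_extension \<iota> G (Poly_Mapping.single \<mu> x) = \<iota> x * G \<mu>"
  by (simp add: linear_extension_def zero)

lemma linear_extension_scale:
  "linear_extension \<iota> G (Poly_Mapping.map ((*) x) c) = \<iota> x * linear_extension \<iota> G c"
proof -
  have lookup: "Poly_Mapping.lookup (Poly_Mapping.map ((*) x) c) \<mu> = x * Poly_Mapping.lookup c \<mu>" for \<mu>
    by (simp add: Poly_Mapping.map.rep_eq when_def)
  have "linear_extension \<iota> G (Poly_Mapping.map ((*) x) c) =
      (\<Sum>\<mu>\<in>Poly_Mapping.keys c. \<iota> (x * Poly_Mapping.lookup c \<mu>) * G \<mu>)"
    unfolding linear_extension_def lookup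
    by (rule sum.mono_neutral_left) (auto simp: in_keys_iff lookup zero)
  then show ?thesis
    by (simp add: linear_extension_def mult sum_distrib_left mult.assoc)
qed

end

interpretation const: scalar_embedding "mps_const :: ratqt \<Rightarrow> _"
  by unfold_locales (simp_all add: mps_const_add mps_const_mult)

lemma is_psum_expansion_add:
  assumes "is_psum_expansion c F" "is_psum_expansion d G"
  shows "is_psum_expansion (c + d) (F + G)"
  using assms keys_add[of c d] by (auto simp: is_psum_expansion_iff const.linear_extension_add)

lemma is_psum_expansion_scale:
  assumes "is_psum_expansion c F"
  shows "is_psum_expansion (Poly_Mapping.map ((*) x) c) (mps_const x * F)"
  using assms by (auto simp: is_psum_expansion_iff const.linear_extension_scale in_keys_iff
      Poly_Mapping.map.rep_eq when_def)

lemma is_psum_expansion_psum_prod: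
  assumes "0 \<notin># \<mu>"
  shows "is_psum_expansion (Poly_Mapping.single \<mu> 1) (psum_prod \<mu>)"
  using assms by (simp add: is_psum_expansion_iff const.linear_extension_single)

lemma is_psum_expansion_0: "is_psum_expansion 0 0"
  by (simp add: is_psum_expansion_def)

text \<open>Linear independence by triangularity: take \<mu> with the most parts in the support and
  a monomial with exponents \<mu>. Among the products in the support, only that of \<mu> contains
  this monomial.\<close>

lemma psum_eval_eq_0_imp:
  assumes "\<forall>\<mu>\<in>Poly_Mapping.keys c. 0 \<notin># \<mu>" "psum_eval c = 0"
  shows "c = 0"
proof (rule ccontr)
  assume "c \<noteq> 0"
  then have ne: "Poly_Mapping.keys c \<noteq> {}"
    by simp
  obtain \<mu> where \<mu>: "\<mu> \<in> Poly_Mapping.keys c"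
    and max: "\<And>\<nu>. \<nu> \<in> Poly_Mapping.keys c \<Longrightarrow> size \<nu> \<le> size \<mu>"
    using Max_in[of "size ` Poly_Mapping.keys c"] Max_ge[of "size ` Poly_Mapping.keys c"] ne
    by (metis (no_types, lifting) finite_imageI finite_keys image_iff image_is_empty)
  obtain m where m: "exponents m = \<mu>"
    using exponents_surj \<mu> assms(1) by blast
  have zero: "mps_coeff (psum_prod \<nu>) m = 0" if "\<nu> \<in> Poly_Mapping.keys c - {\<mu>}" for \<nu>
  proof (rule ccontr)
    assume nz: "mps_coeff (psum_prod \<nu>) m \<noteq> 0"
    have "0 \<notin># \<nu>" "size \<nu> \<le> size \<mu>"
      using that assms(1) max by auto
    moreover have "card (set_mset m) = size \<mu>"
      using m by auto
    ultimately show False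
      using psum_prod_coeff_nonzero[OF nz] m that by auto
  qed
  have "0 = mps_coeff (psum_eval c) m"
    by (simp add: assms)
  also have "\<dots> = (\<Sum>\<nu>\<in>Poly_Mapping.keys c. Poly_Mapping.lookup c \<nu> * mps_coeff (psum_prod \<nu>) m)"
    by (simp add: linear_extension_def mps_coeff_sum)
  also have "\<dots> = (\<Sum>\<nu>\<in>{\<mu>}. Poly_Mapping.lookup c \<nu> * mps_coeff (psum_prod \<nu>) m)"
    using \<mu> zero by (intro sum.mono_neutral_right) auto
  finally show False
    using \<mu> psum_prod_coeff_exponents[OF m] by (simp add: in_keys_iff)
qed

lemma is_psum_expansion_unique:
  assumes "is_psum_expansion c F" "is_psum_expansion d F"
  shows "c = d"
proof -
  have "psum_eval c = psum_eval (c - d) + psum_eval d"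
    by (simp flip: const.linear_extension_add)
  then have "c - d = 0"
    using assms keys_diff[of c d] by (intro psum_eval_eq_0_imp) (auto simp: is_psum_expansion_iff)
  then show ?thesis
    by simp
qed

lemma psum_expansion_eqI: "is_psum_expansion c F \<Longrightarrow> psum_expansion F = c"
  unfolding psum_expansion_def by (rule the_equality) (auto intro: is_psum_expansion_unique)

section \<open>Power sum products span the symmetric functions\<close>

definition in_psum_span :: "ratqt mps \<Rightarrow> bool" where
  "in_psum_span F \<longleftrightarrow> (\<exists>c. is_psum_expansion c F)"

lemma in_psum_span_0: "in_psum_span 0"
  unfolding in_psum_span_def using is_psum_expansion_0 by blast

lemma in_psum_span_add: "in_psum_span F \<Longrightarrow> in_psum_span G \<Longrightarrow> in_psum_span (F + G)"
  unfolding in_psum_span_def using is_psum_expansion_add by blast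

lemma in_psum_span_psum_prod: "0 \<notin># \<mu> \<Longrightarrow> in_psum_span (mps_const x * psum_prod \<mu>)"
  unfolding in_psum_span_def using is_psum_expansion_psum_prod is_psum_expansion_scale by blast

lemma in_psum_span_sum:
  "(\<And>x. x \<in> A \<Longrightarrow> in_psum_span (f x)) \<Longrightarrow> in_psum_span (\<Sum>x\<in>A. f x)"
  by (induction A rule: infinite_finite_induct) (auto intro: in_psum_span_0 in_psum_span_add)

text \<open>Induction on a strict bound for the number of variables in a monomial. Products with
  \<open>n\<close> factors suffice to match \<open>F\<close> on its monomials in \<open>n\<close>
  variables, and the difference only has monomials in fewer variables.\<close>

lemma Lam_in_psum_span_bounded:
  assumes "F \<in> Lam" "\<And>m. mps_coeff F m \<noteq> 0 \<Longrightarrow> card (set_mset m) < n"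
  shows "in_psum_span F"
  using assms
proof (induction n arbitrary: F)
  case 0
  then have "F = 0"
    by (intro mps_eqI) auto
  then show ?case
    by (simp add: in_psum_span_0)
next
  case (Suc n)
  obtain d where d: "\<And>m. size m > d \<Longrightarrow> mps_coeff F m = 0"
    using Suc.prems(1) by (rule Lam_degreeE) blast
  obtain mon where mon: "\<And>\<mu>. 0 \<notin># \<mu> \<Longrightarrow> exponents (mon \<mu>) = \<mu>"
    using exponents_surj by metis
  \<comment> \<open>The degree bound \<open>d\<close> bounds the parts, so finitely many partitions
    suffice.\<close>
  define T where "T = multisets_of_size {1..d} n"
  \<comment> \<open>Solves the triangular system on its diagonal.\<close>
  define f where "f \<mu> = mps_coeff F (mon \<mu>) / mps_coeff (psum_prod \<mu>) (mon \<mu>)" for \<mu>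
  define G where "G = (\<Sum>\<mu>\<in>T. mps_const (f \<mu>) * psum_prod \<mu>)"
  have "finite T"
    by (auto simp: T_def)
  have T: "0 \<notin># \<mu>" "size \<mu> = n" if "\<mu> \<in> T" for \<mu>
    using that by (auto simp: T_def multisets_of_size_def)
  have "G \<in> Lam"
    unfolding G_def by (intro Lam_sum Lam_const_mult Lam_psum_prod)
  \<comment> \<open>Among monomials with at least \<open>n\<close> variables, a product of
    \<open>n\<close> factors contains only those whose exponents are its own parts, so at most one
    term of \<open>G\<close> contributes.\<close>
  have coeff_G: "mps_coeff G m = (if exponents m \<in> T then mps_coeff F m else 0)"
    if "card (set_mset m) \<ge> n" for m
  proof -
    have zero: "mps_coeff (psum_prod \<mu>) m = 0" if "\<mu> \<in> T" "\<mu> \<noteq> exponents m" for \<mu>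
      using psum_prod_coeff_nonzero[of \<mu> m] T[OF that(1)] that \<open>card (set_mset m) \<ge> n\<close> by force
    have "mps_coeff G m = (\<Sum>\<mu>\<in>T. f \<mu> * mps_coeff (psum_prod \<mu>) m)"
      by (simp add: G_def mps_coeff_sum)
    also have "\<dots> = (\<Sum>\<mu>\<in>T. if \<mu> = exponents m then f \<mu> * mps_coeff (psum_prod \<mu>) m else 0)"
      using zero by (intro sum.cong) auto
    also have "\<dots> = (if exponents m \<in> T then f (exponents m) * mps_coeff (psum_prod (exponents m)) m else 0)"
      using \<open>finite T\<close> by simp
    also have "f (exponents m) * mps_coeff (psum_prod (exponents m)) m = mps_coeff F m"
    proof -
      have "exponents (mon (exponents m)) = exponents m"
        by (rule mon) simp
      then have "mps_coeff F (mon (exponents m)) = mps_coeff F m"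
        "mps_coeff (psum_prod (exponents m)) (mon (exponents m)) = mps_coeff (psum_prod (exponents m)) m"
        using Lam_coeff_exponents_cong Suc.prems(1) Lam_psum_prod by blast+
      then show ?thesis
        using psum_prod_coeff_exponents[OF refl, of m] by (simp add: f_def)
    qed
    finally show ?thesis .
  qed
  have "mps_coeff (F - G) m = 0" if "card (set_mset m) \<ge> n" for m
  proof (cases "mps_coeff F m = 0")
    case False
    then have "card (set_mset m) = n" "size m \<le> d"
      using Suc.prems(2)[of m] d[of m] that by force+
    moreover have "x \<le> \<Sum>\<^sub># (exponents m)" if "x \<in># exponents m" for x
      using that by (metis multi_member_split le_add1 sum_mset.add_mset)
    moreover have "x > 0" if "x \<in># exponents m" for x
      using that zero_notin_exponents[of m] by (metis gr0I)
    ultimately have "exponents m \<in> T"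
      by (force simp: T_def multisets_of_size_def)
    then show ?thesis
      by (simp add: coeff_G that)
  qed (simp add: coeff_G that)
  then have "in_psum_span (F - G)"
    using Suc.prems(1) \<open>G \<in> Lam\<close> by (intro Suc.IH) (auto simp: not_le[symmetric] simp del: mps_coeff_diff)
  moreover have "in_psum_span G"
    unfolding G_def using T by (intro in_psum_span_sum in_psum_span_psum_prod) auto
  ultimately show ?case
    using in_psum_span_add[of "F - G" G] by simp
qed

lemma Lam_in_psum_span:
  assumes "F \<in> Lam"
  shows "in_psum_span F"
proof -
  obtain d where d: "\<And>m. size m > d \<Longrightarrow> mps_coeff F m = 0"
    using assms by (rule Lam_degreeE) blast
  show ?thesis
  proof (rule Lam_in_psum_span_bounded[OF assms])
    fix m assume "mps_coeff F m \<noteq> 0"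
    then have "size m \<le> d"
      using d[of m] by force
    moreover have "card (set_mset m) \<le> size m"
      by (induction m) (auto simp: card_insert_if)
    ultimately show "card (set_mset m) < Suc d"
      by simp
  qed
qed

lemma is_psum_expansion_psum_expansion: "F \<in> Lam \<Longrightarrow> is_psum_expansion (psum_expansion F) F"
  using Lam_in_psum_span in_psum_span_def psum_expansion_eqI by metis

lemma psum_expansion_add:
  "F \<in> Lam \<Longrightarrow> G \<in> Lam \<Longrightarrow> psum_expansion (F + G) = psum_expansion F + psum_expansion G"
  by (intro psum_expansion_eqI is_psum_expansion_add is_psum_expansion_psum_expansion)

lemma psum_expansion_scale:
  "F \<in> Lam \<Longrightarrow> psum_expansion (mps_const x * F) = Poly_Mapping.map ((*) x) (psum_expansion F)"
  by (intro psum_expansion_eqI is_psum_expansion_scale is_psum_expansion_psum_expansion)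

lemma psum_expansion_psum_prod:
  "0 \<notin># \<mu> \<Longrightarrow> psum_expansion (psum_prod \<mu>) = Poly_Mapping.single \<mu> 1"
  by (intro psum_expansion_eqI is_psum_expansion_psum_prod)

text \<open>Spanning in the form of an induction rule, for identities linear in \<open>F\<close>
  that are explicit on products.\<close>

lemma Lam_span_induct [consumes 1, case_names psum_prod scale add]:
  assumes "F \<in> Lam"
    and psum_prod: "\<And>\<mu>. 0 \<notin># \<mu> \<Longrightarrow> P (psum_prod \<mu>)"
    and scale: "\<And>F x. F \<in> Lam \<Longrightarrow> P F \<Longrightarrow> P (mps_const x * F)"
    and add: "\<And>F G. F \<in> Lam \<Longrightarrow> G \<in> Lam \<Longrightarrow> P F \<Longrightarrow> P G \<Longrightarrow> P (F + G)"
  shows "P F"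
proof -
  have P0: "P 0"
    using scale[of "psum_prod {#}" 0] psum_prod[of "{#}"] by simp
  have sum: "(\<Sum>\<mu>\<in>A. f \<mu>) \<in> Lam \<and> P (\<Sum>\<mu>\<in>A. f \<mu>)" if "\<And>\<mu>. \<mu> \<in> A \<Longrightarrow> f \<mu> \<in> Lam \<and> P (f \<mu>)"
    for A and f :: "nat multiset \<Rightarrow> ratqt mps"
    using that by (induction A rule: infinite_finite_induct) (auto intro: P0 add)
  have c: "\<forall>\<mu>\<in>Poly_Mapping.keys (psum_expansion F). 0 \<notin># \<mu>"
    and F: "F = psum_eval (psum_expansion F)"
    using is_psum_expansion_psum_expansion[OF assms(1)] by (auto simp: is_psum_expansion_iff)
  have "P (psum_eval (psum_expansion F))"
    unfolding linear_extension_def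
    using c by (intro sum[THEN conjunct2]) (auto intro: psum_prod scale)
  with F show ?thesis
    by metis
qed

text \<open>Peels off one factor at a time, for operators known through their value at 1 and their
  commutators with power sums.\<close>

lemma Lam_induct [consumes 1, case_names one psum_mult scale add]:
  assumes "F \<in> Lam" "P 1"
    and psum_mult: "\<And>F r. F \<in> Lam \<Longrightarrow> r > 0 \<Longrightarrow> P F \<Longrightarrow> P (psum r * F)"
    and scale: "\<And>F x. F \<in> Lam \<Longrightarrow> P F \<Longrightarrow> P (mps_const x * F)"
    and add: "\<And>F G. F \<in> Lam \<Longrightarrow> G \<in> Lam \<Longrightarrow> P F \<Longrightarrow> P G \<Longrightarrow> P (F + G)"
  shows "P F"
  using assms(1)
proof (induction rule: Lam_span_induct)
  case (psum_prod \<mu>)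
  then show ?case
    by (induction \<mu>) (auto intro!: psum_mult simp: assms)
qed (use scale add in auto)

section \<open>Linear maps defined on power sum products\<close>

context scalar_embedding
begin

lemma linear_extension_psum_expansion_add:
  "F \<in> Lam \<Longrightarrow> G \<in> Lam \<Longrightarrow> linear_extension \<iota> g (psum_expansion (F + G)) =
     linear_extension \<iota> g (psum_expansion F) + linear_extension \<iota> g (psum_expansion G)"
  by (simp add: psum_expansion_add linear_extension_add)

lemma linear_extension_psum_expansion_scale:
  "F \<in> Lam \<Longrightarrow> linear_extension \<iota> g (psum_expansion (mps_const x * F)) =
     \<iota> x * linear_extension \<iota> g (psum_expansion F)"
  by (simp add: psum_expansion_scale linear_extension_scale)

lemma linear_extension_psum_expansion_psum_prod:
  "0 \<notin># \<mu> \<Longrightarrow> linear_extension \<iota> g (psum_expansion (psum_prod \<mu>)) = g \<mu>"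
  by (simp add: psum_expansion_psum_prod linear_extension_single one)

end

interpretation fls_const: scalar_embedding "\<lambda>x :: ratqt. fls_const (mps_const x)"
  by unfold_locales (simp_all add: mps_const_add mps_const_mult fls_plus_const)

lemma plethysm_conv_linear_extension:
  "plethysm F P = linear_extension (\<lambda>x. fls_const (mps_const x)) (\<lambda>\<mu>. \<Prod>r\<in>#\<mu>. P r) (psum_expansion F)"
  by (simp add: plethysm_def linear_extension_def)

lemma plethysm_add:
  "F \<in> Lam \<Longrightarrow> G \<in> Lam \<Longrightarrow> plethysm (F + G) P = plethysm F P + plethysm G P"
  by (simp add: plethysm_conv_linear_extension fls_const.linear_extension_psum_expansion_add)

lemma plethysm_scale:
  "F \<in> Lam \<Longrightarrow> plethysm (mps_const x * F) P = fls_const (mps_const x) * plethysm F P"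
  by (simp add: plethysm_conv_linear_extension fls_const.linear_extension_psum_expansion_scale)

lemma plethysm_psum_prod: "0 \<notin># \<mu> \<Longrightarrow> plethysm (psum_prod \<mu>) P = (\<Prod>r\<in>#\<mu>. P r)"
  by (simp add: plethysm_conv_linear_extension fls_const.linear_extension_psum_expansion_psum_prod)

lemma plethysm_1 [simp]: "plethysm 1 P = 1"
  using plethysm_psum_prod[of "{#}" P] by simp

text \<open>Both sides are linear in \<open>F\<close>, and on a product the factor $p_r$ only adds
  the part \<open>r\<close>.\<close>

lemma plethysm_psum_mult:
  assumes "F \<in> Lam" "r > 0"
  shows "plethysm (psum r * F) P = P r * plethysm F P"
  using assms(1)
proof (induction rule: Lam_span_induct)
  case (psum_prod \<mu>)
  then show ?case
    using plethysm_psum_prod[of "add_mset r \<mu>" P] assms(2) by (simp add: plethysm_psum_prod)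
next
  case (scale F x)
  then show ?case
    unfolding mult.left_commute[of "psum r" "mps_const x"]
    by (simp add: plethysm_scale mult.left_commute[of "P r"])
qed (simp_all add: distrib_left plethysm_add)

section \<open>Differentiation by a power sum\<close>

definition psum_deriv :: "nat \<Rightarrow> ratqt mps \<Rightarrow> ratqt mps" where
  "psum_deriv r F =
     linear_extension mps_const (\<lambda>\<mu>. of_nat (count \<mu> r) * psum_prod (\<mu> - {#r#})) (psum_expansion F)"

lemma psum_deriv_add:
  "F \<in> Lam \<Longrightarrow> G \<in> Lam \<Longrightarrow> psum_deriv r (F + G) = psum_deriv r F + psum_deriv r G"
  by (simp add: psum_deriv_def const.linear_extension_psum_expansion_add)

lemma psum_deriv_scale:
  "F \<in> Lam \<Longrightarrow> psum_deriv r (mps_const x * F) = mps_const x * psum_deriv r F"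
  by (simp add: psum_deriv_def const.linear_extension_psum_expansion_scale)

lemma psum_deriv_sum:
  "(\<And>x. x \<in> A \<Longrightarrow> f x \<in> Lam) \<Longrightarrow> psum_deriv r (\<Sum>x\<in>A. f x) = (\<Sum>x\<in>A. psum_deriv r (f x))"
  using psum_deriv_scale[of 1 r 0]
  by (induction A rule: infinite_finite_induct) (auto simp: psum_deriv_add Lam_sum)

lemma psum_deriv_psum_prod:
  "0 \<notin># \<mu> \<Longrightarrow> psum_deriv r (psum_prod \<mu>) = of_nat (count \<mu> r) * psum_prod (\<mu> - {#r#})"
  by (simp add: psum_deriv_def const.linear_extension_psum_expansion_psum_prod)

lemma psum_deriv_1 [simp]: "psum_deriv r 1 = 0"
  using psum_deriv_psum_prod[of "{#}" r] by simp

lemma psum_deriv_psum_mult: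
  assumes "F \<in> Lam" "s > 0"
  shows "psum_deriv r (psum s * F) = (if r = s then F else 0) + psum s * psum_deriv r F"
  using assms(1)
proof (induction rule: Lam_span_induct)
  case (psum_prod \<mu>)
  have "psum_deriv r (psum s * psum_prod \<mu>) =
      of_nat (count (add_mset s \<mu>) r) * psum_prod (add_mset s \<mu> - {#r#})"
    using psum_deriv_psum_prod[of "add_mset s \<mu>" r] assms(2) psum_prod by simp
  \<comment> \<open>Restores the removed factor; if \<open>r\<close> is not a part of \<mu>, both
    sides vanish because the count is 0.\<close>
  moreover have "of_nat (count \<mu> r) * psum_prod \<mu> = of_nat (count \<mu> r) * (psum r * psum_prod (\<mu> - {#r#}))"
    by (cases "r \<in># \<mu>") (auto simp: not_in_iff dest!: multi_member_split)
  ultimately show ?case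
    using psum_prod by (auto simp: psum_deriv_psum_prod algebra_simps)
next
  case (scale F x)
  then show ?case
    unfolding mult.left_commute[of "psum s" "mps_const x"]
    by (simp add: psum_deriv_scale distrib_left mult.left_commute[of "psum s"])
next
  case (add F G)
  then show ?case
    by (simp add: distrib_left psum_deriv_add)
qed

lemma Lam_psum_deriv [simp, intro]: "F \<in> Lam \<Longrightarrow> psum_deriv r F \<in> Lam"
  by (induction rule: Lam_induct) (auto simp: psum_deriv_psum_mult psum_deriv_scale psum_deriv_add)

section \<open>The operators $D_k$\<close>

text \<open>Since \<Omega>[-zX] is the product of all $1 - x_i z$, this is $(-1)^n e_n[X]$, and its
  recursion is Newton's identity.\<close>

definition Omega_coeff :: "nat \<Rightarrow> ratqt mps" where
  "Omega_coeff n = fps_nth (Omega_z (\<lambda>k. - psum k)) n"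

lemma Omega_coeff_0 [simp]: "Omega_coeff 0 = 1"
  by (simp add: Omega_coeff_def Omega_z_def)

text \<open>
  The logarithmic derivative of $\Omega$.  The chain rule \<open>fps_compose_deriv\<close> requires an integral
  domain and so does not apply to coefficients in \<open>mps\<close>.
\<close>

lemma Omega_coeff_Suc:
  "of_nat (Suc n) * Omega_coeff (Suc n) = - (\<Sum>i\<le>n. psum (Suc i) * Omega_coeff (n - i))"
proof -
  define b :: "ratqt mps fps"
    where "b = Abs_fps (\<lambda>k. if k = 0 then 0 else mps_const (1 / of_nat k) * - psum k)"
  define e :: "nat \<Rightarrow> ratqt mps" where "e n = mps_const (1 / of_nat (fact n))" for n
  have b0: "fps_nth b 0 = 0"
    by (simp add: b_def)
  have Omega: "Omega_coeff n = (\<Sum>i\<le>n. e i * fps_nth (b ^ i) n)" for n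
    by (simp add: Omega_coeff_def Omega_z_def fps_compose_nth b_def e_def atMost_atLeast0)
  \<comment> \<open>\<open>b\<close> has no constant term, so \<open>b ^ i\<close> vanishes below
    order \<open>i\<close>. One summation bound thus serves every \<open>k\<close>, which makes the
    later exchange of sums possible.\<close>
  have Omega': "Omega_coeff k = (\<Sum>i\<le>n. e i * fps_nth (b ^ i) k)" if "k \<le> n" for k
    unfolding Omega using that startsby_zero_power_prefix[OF b0]
    by (intro sum.mono_neutral_left) auto
  have e: "e (Suc i) * of_nat (Suc i) = e i" for i
  proof -
    have "e (Suc i) * of_nat (Suc i) = mps_const (1 / of_nat (fact (Suc i)) * of_nat (Suc i))"
      unfolding e_def mps_const_mult mps_const_of_nat ..
    also have "of_nat (fact (Suc i)) = (of_nat (Suc i) * of_nat (fact i) :: ratqt)"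
      by (simp only: fact_Suc of_nat_mult of_nat_id)
    also have "1 / (of_nat (Suc i) * of_nat (fact i)) * of_nat (Suc i) = (1 / of_nat (fact i) :: ratqt)"
      by (simp del: of_nat_Suc of_nat_fact)
    finally show ?thesis
      by (simp add: e_def)
  qed
  have b': "fps_nth (fps_deriv b) i = - psum (Suc i)" for i
  proof -
    have "fps_nth (fps_deriv b) i = mps_const (of_nat (Suc i) * (1 / of_nat (Suc i))) * - psum (Suc i)"
      unfolding mps_const_mult mps_const_of_nat by (simp add: b_def mult.assoc del: of_nat_Suc)
    also have "of_nat (Suc i) * (1 / of_nat (Suc i)) = (1 :: ratqt)"
      by (simp del: of_nat_Suc)
    finally show ?thesis
      by simp
  qed
  have pow: "of_nat (Suc n) * fps_nth (b ^ Suc i) (Suc n) =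
      of_nat (Suc i) * (\<Sum>k\<le>n. fps_nth (fps_deriv b) k * fps_nth (b ^ i) (n - k))" for i
  proof -
    have "of_nat (Suc n) * fps_nth (b ^ Suc i) (Suc n) = fps_nth (fps_deriv (b ^ Suc i)) n"
      by (simp only: fps_deriv_nth Suc_eq_plus1)
    also have "fps_deriv (b ^ Suc i) = fps_const (of_nat (Suc i)) * (fps_deriv b * b ^ i)"
      by (simp only: fps_deriv_power diff_Suc_1 mult.assoc)
    finally show ?thesis
      by (simp only: fps_mult_left_const_nth fps_mult_nth[of "fps_deriv b"] atMost_atLeast0)
  qed
  have "of_nat (Suc n) * Omega_coeff (Suc n) =
      (\<Sum>i\<le>Suc n. e i * (of_nat (Suc n) * fps_nth (b ^ i) (Suc n)))"
    by (simp only: Omega sum_distrib_left mult_ac)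
  \<comment> \<open>The term for exponent 0 drops out, as \<open>b ^ 0\<close> is 1 and the order is
    positive.\<close>
  also have "\<dots> = (\<Sum>i\<le>n. e (Suc i) * (of_nat (Suc n) * fps_nth (b ^ Suc i) (Suc n)))"
    by (subst sum.atMost_Suc_shift) simp
  also have "\<dots> = (\<Sum>i\<le>n. \<Sum>k\<le>n. fps_nth (fps_deriv b) k * (e i * fps_nth (b ^ i) (n - k)))"
    unfolding pow mult.assoc[symmetric] e by (simp add: sum_distrib_left mult_ac)
  also have "\<dots> = (\<Sum>k\<le>n. fps_nth (fps_deriv b) k * Omega_coeff (n - k))"
    by (subst sum.swap) (simp add: Omega' sum_distrib_left)
  finally show ?thesis
    by (simp only: b' mult_minus_left sum_negf)
qed

lemma of_nat_mult_eq_imp: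
  assumes "of_nat n * F = of_nat n * G" "n > 0"
  shows "F = (G :: ratqt mps)"
proof -
  have "mps_const (of_nat n) * (F - G) = 0"
    using assms(1) by (simp add: mps_const_of_nat right_diff_distrib)
  then show ?thesis
    using mps_const_mult_eq_0D[of "of_nat n" "F - G"] assms(2) by simp
qed

text \<open>Dividing the recursion by \<open>n\<close> expresses each coefficient through power sums
  and earlier coefficients.\<close>

lemma Lam_Omega_coeff [simp, intro]: "Omega_coeff n \<in> Lam"
proof (induction n rule: less_induct)
  case (less n)
  show ?case
  proof (cases n)
    case (Suc k)
    have "Omega_coeff n = mps_const (1 / of_nat n) * (of_nat n * Omega_coeff n)"
      using Suc by (simp flip: mps_const_of_nat mps_const_mult mult.assoc del: of_nat_Suc)
    also have "\<dots> \<in> Lam"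
      unfolding Suc Omega_coeff_Suc
      using less Suc by (intro Lam_const_mult Lam_uminus Lam_sum Lam_mult Lam_psum) auto
    finally show ?thesis .
  qed simp
qed

text \<open>Infinitesimal form of $\Omega[-z(X + Y)] = \Omega[-zX]\,\Omega[-zY]$.\<close>

lemma psum_deriv_Omega_coeff:
  assumes "r > 0"
  shows "psum_deriv r (Omega_coeff n) =
    (if r \<le> n then - mps_const (1 / of_nat r) * Omega_coeff (n - r) else 0)"
proof (induction n rule: less_induct)
  case (less n)
  show ?case
  proof (cases n)
    case 0
    then show ?thesis
      using assms by simp
  next
    case (Suc k)
    define c where "c = mps_const (1 / of_nat r :: ratqt)"
    have rc: "of_nat r * c = 1"
      using assms by (simp add: c_def flip: mps_const_of_nat mps_const_mult)
    have "of_nat n * psum_deriv r (Omega_coeff n) = psum_deriv r (of_nat n * Omega_coeff n)"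
      using psum_deriv_scale[of "Omega_coeff n" r "of_nat n"] by (simp add: mps_const_of_nat)
    also have "\<dots> = psum_deriv r (mps_const (- 1) * (\<Sum>i\<le>k. psum (Suc i) * Omega_coeff (k - i)))"
      unfolding Suc Omega_coeff_Suc by (simp add: mps_const_uminus)
    also have "\<dots> = - (\<Sum>i\<le>k. psum_deriv r (psum (Suc i) * Omega_coeff (k - i)))"
      by (subst psum_deriv_scale) (auto simp: psum_deriv_sum mps_const_uminus intro!: Lam_sum)
    also have "\<dots> = - (\<Sum>i\<le>k. if Suc i = r then Omega_coeff (k - i) else 0)
        - (\<Sum>i\<le>k. psum (Suc i) * psum_deriv r (Omega_coeff (k - i)))"
      by (simp add: psum_deriv_psum_mult sum.distrib eq_commute)
    \<comment> \<open>The Leibniz rule differentiates the power sum itself only at the index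
      \<open>r - 1\<close>, which exists exactly for \<open>r \<le> n\<close>.\<close>
    also have "(\<Sum>i\<le>k. if Suc i = r then Omega_coeff (k - i) else 0) =
        (\<Sum>i\<le>k. if i = r - 1 then Omega_coeff (n - r) else 0)"
      using assms Suc by (intro sum.cong) auto
    also have "\<dots> = (if r \<le> n then Omega_coeff (n - r) else 0)"
      using assms Suc by auto
    also have "(\<Sum>i\<le>k. psum (Suc i) * psum_deriv r (Omega_coeff (k - i))) =
        (\<Sum>i\<le>k. if r \<le> k - i then - c * (psum (Suc i) * Omega_coeff (k - i - r)) else 0)"
      using Suc by (intro sum.cong refl) (auto simp: less c_def)
    \<comment> \<open>After the factor $-1/r$ is pulled out, the recursion for \<open>n - r\<close>
      remains. For \<open>r = n\<close> both sides are 0.\<close>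
    also have "\<dots> = (if r \<le> n then of_nat (n - r) * c * Omega_coeff (n - r) else 0)"
    proof (cases "r \<le> k")
      case True
      then have "n - r = Suc (k - r)"
        using Suc by simp
      have "(\<Sum>i\<le>k. if r \<le> k - i then - c * (psum (Suc i) * Omega_coeff (k - i - r)) else 0) =
          (\<Sum>i\<le>k - r. - c * (psum (Suc i) * Omega_coeff (k - r - i)))"
        using True by (intro sum.mono_neutral_cong_right) (auto simp: add.commute)
      also have "\<dots> = c * (of_nat (n - r) * Omega_coeff (n - r))"
        unfolding \<open>n - r = Suc (k - r)\<close> Omega_coeff_Suc by (simp add: sum_distrib_left sum_negf)
      finally show ?thesis
        using True Suc by (simp add: mult_ac)
    next
      case False
      then show ?thesis
        using Suc by (auto intro!: sum.neutral)
    qed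
    finally have *: "of_nat n * psum_deriv r (Omega_coeff n) =
      (if r \<le> n then - (1 + of_nat (n - r) * c) * Omega_coeff (n - r) else 0)"
      by (simp add: algebra_simps split: if_splits)
    \<comment> \<open>The two contributions $1$ and $(n-r)/r$ add up to $n/r$, so that
      \<open>n\<close> cancels.\<close>
    have "of_nat n * c = 1 + of_nat (n - r) * c" if "r \<le> n"
      using that rc by (simp add: of_nat_diff algebra_simps)
    then have "of_nat n * (- c * Omega_coeff (n - r)) =
        - (1 + of_nat (n - r) * c) * Omega_coeff (n - r)" if "r \<le> n"
      using that by (simp only: mult_minus_left mult_minus_right mult.assoc[symmetric])
    then have "of_nat n * psum_deriv r (Omega_coeff n) =
      of_nat n * (if r \<le> n then - c * Omega_coeff (n - r) else 0)"
      unfolding * by (cases "r \<le> n") (simp_all only: if_True if_False mult_zero_right)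
    then show ?thesis
      unfolding c_def by (rule of_nat_mult_eq_imp) (simp add: Suc)
  qed
qed

lemma D_op_1: "D_op k 1 = (if k < 0 then 0 else Omega_coeff (nat k))"
  by (simp add: D_op_def Omega_coeff_def)

lemma D_op_add: "F \<in> Lam \<Longrightarrow> G \<in> Lam \<Longrightarrow> D_op k (F + G) = D_op k F + D_op k G"
  by (simp add: D_op_def plethysm_add distrib_right)

lemma D_op_scale: "F \<in> Lam \<Longrightarrow> D_op k (mps_const x * F) = mps_const x * D_op k F"
  by (simp add: D_op_def plethysm_scale mult.assoc)

text \<open>Plethysm turns $p_r$ into $p_r[X] + p_r[M] z^{-r}$, and the factor $z^{-r}$ moves the
  extracted coefficient from \<open>k\<close> to \<open>k + r\<close>.\<close>

lemma D_op_psum_mult: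
  assumes "F \<in> Lam" "r > 0"
  shows "D_op k (psum r * F) = psum r * D_op k F + mps_const (p_M r) * D_op (k + int r) F"
proof -
  have "fls_nth (fls_const c * fls_X_inv ^ r * f) k = c * fls_nth f (k + int r)"
    for c :: "ratqt mps" and f
    by (simp only: mult.assoc fls_X_inv_power_times_conv_shift(1) fls_mult_const_nth fls_shift_nth)
  then show ?thesis
    using assms
    by (simp add: D_op_def plethysm_psum_mult p_X_plus_M_over_z_def distrib_right
        mult.assoc[of _ "plethysm F _"] mult.assoc[of "fls_const (psum r)"])
qed

lemma Lam_D_op [simp, intro]: "F \<in> Lam \<Longrightarrow> D_op k F \<in> Lam"
proof (induction arbitrary: k rule: Lam_induct)
  case one
  then show ?case
    by (simp add: D_op_1)
qed (simp_all add: D_op_psum_mult D_op_add D_op_scale)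

text \<open>For \<open>F = 1\<close> this is the derivative of the coefficients of \<Omega>.
  Multiplying \<open>F\<close> by $p_s$ preserves the relation: index shifts by $s$ and $-r$
  commute, and for $r = s$ the extra Leibniz term is $D_k F$ on both sides.\<close>

lemma D_op_psum_deriv:
  assumes "F \<in> Lam" "r > 0"
  shows "D_op k (psum_deriv r F) =
    psum_deriv r (D_op k F) + mps_const (1 / of_nat r) * D_op (k - int r) F"
  using assms(1)
proof (induction arbitrary: k rule: Lam_induct)
  case one
  have "D_op k 0 = 0"
    using D_op_scale[of 1 k 0] by simp
  moreover have "psum_deriv r 0 = 0"
    using psum_deriv_scale[of 1 r 0] by simp
  ultimately show ?case
    using assms(2)
    by (auto simp: D_op_1 psum_deriv_Omega_coeff nat_diff_distrib)
next
  case (psum_mult F s)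
  have "D_op k 0 = 0"
    using D_op_scale[of 1 k 0] by simp
  moreover have "k - int r + int s = k + int s - int r"
    by simp
  ultimately show ?case
    using psum_mult
    by (simp add: psum_deriv_psum_mult psum_deriv_add psum_deriv_scale D_op_psum_mult D_op_add)
      (simp add: algebra_simps)
next
  case (scale F x)
  then show ?case
    by (simp add: D_op_scale psum_deriv_scale distrib_left mult.left_commute)
next
  case (add F G)
  then show ?case
    by (simp add: D_op_add psum_deriv_add distrib_left)
qed

section \<open>Symmetric functions of the index shifts\<close>

text \<open>
  Let $z_i$ act on words by shifting the \<open>i\<close>-th index by \<open>s\<close>.  Then \<open>elem_shift s j a\<close> is the operator
  $e_j(z) D_a$ and \<open>psum_elem_shift s i j a\<close> is $p_i(z) e_j(z) D_a$.
\<close>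

fun elem_shift :: "int \<Rightarrow> nat \<Rightarrow> int list \<Rightarrow> ratqt mps \<Rightarrow> ratqt mps" where
  "elem_shift s j [] F = (if j = 0 then F else 0)"
| "elem_shift s j (x # a) F =
     elem_shift s j a (D_op x F) + (if j = 0 then 0 else elem_shift s (j - 1) a (D_op (x + s) F))"

fun psum_elem_shift :: "int \<Rightarrow> nat \<Rightarrow> nat \<Rightarrow> int list \<Rightarrow> ratqt mps \<Rightarrow> ratqt mps" where
  "psum_elem_shift s i j [] F = 0"
| "psum_elem_shift s i j (x # a) F =
     psum_elem_shift s i j a (D_op x F) + elem_shift s j a (D_op (x + s * int i) F) +
     (if j = 0 then 0
      else psum_elem_shift s i (j - 1) a (D_op (x + s) F) +
           elem_shift s (j - 1) a (D_op (x + s + s * int i) F))"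

lemma elem_shift_0: "elem_shift s 0 a F = D_word a F"
  by (induction a arbitrary: F) (simp_all add: D_word_def)

text \<open>Fewer than \<open>j\<close> variables admit no product of \<open>j\<close> distinct
  ones.\<close>

lemma elem_shift_eq_0: "length a < j \<Longrightarrow> elem_shift s j a F = 0"
  by (induction a arbitrary: j F) auto

text \<open>The top elementary symmetric function is the product of all $z_i$.\<close>

lemma elem_shift_length: "elem_shift s (length a) a F = D_word (map (\<lambda>x. x + s) a) F"
  by (induction a arbitrary: F) (simp_all add: D_word_def elem_shift_eq_0)

lemma Lam_elem_shift [simp, intro]: "F \<in> Lam \<Longrightarrow> elem_shift s j a F \<in> Lam"
  by (induction a arbitrary: j F) auto

lemma elem_shift_add:
  "F \<in> Lam \<Longrightarrow> G \<in> Lam \<Longrightarrow> elem_shift s j a (F + G) = elem_shift s j a F + elem_shift s j a G"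
  by (induction a arbitrary: j F G) (simp_all add: D_op_add)

lemma elem_shift_scale:
  "F \<in> Lam \<Longrightarrow> elem_shift s j a (mps_const x * F) = mps_const x * elem_shift s j a F"
  by (induction a arbitrary: j F) (simp_all add: D_op_scale distrib_left)

text \<open>Splitting off the variable $z_1$ of the first letter, with $z'$ the others, via $e_j(z)
  = e_j(z') + z_1 e_{j-1}(z')$ reduces Newton's identity to the remaining letters and a telescoping
  sum.\<close>

lemma elem_shift_newton:
  "of_nat j * elem_shift s j a F =
     (\<Sum>i=1..j. (- 1) ^ (i - 1) * psum_elem_shift s i (j - i) a F)"
proof (induction a arbitrary: j F)
  case Nil
  show ?case
    by simp
next
  case (Cons x a)
  show ?case
  proof (cases j)
    case (Suc k)
    define E where "E i = elem_shift s i a" for i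
    define Q where "Q i l = psum_elem_shift s i l a" for i l
    \<comment> \<open>The term $(-1)^{i-1} z_1^i e_{j-i}(z')$.\<close>
    define h where "h i = (- 1) ^ (i - 1) * E (j - i) (D_op (x + s * int i) F)" for i
    \<comment> \<open>Expands $(p_i(z') + z_1^i)(e_{j-i}(z') + z_1 e_{j-i-1}(z'))$, where the last
      summand is absent for \<open>i = j\<close>.\<close>
    have "(\<Sum>i=1..j. (- 1) ^ (i - 1) * psum_elem_shift s i (j - i) (x # a) F) =
        (\<Sum>i=1..j. (- 1) ^ (i - 1) * Q i (j - i) (D_op x F)) + (\<Sum>i=1..j. h i) +
        (\<Sum>i=1..j. if i = j then 0 else (- 1) ^ (i - 1) * Q i (k - i) (D_op (x + s) F)) +
        (\<Sum>i=1..j. if i = j then 0 else - h (Suc i))"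
      unfolding sum.distrib[symmetric]
    proof (rule sum.cong, goal_cases)
      case (2 i)
      then obtain l where l: "i = Suc l"
        by (cases i) auto
      show ?case
        using 2 by (auto simp: E_def Q_def h_def algebra_simps l Suc)
    qed simp
    also have "(\<Sum>i=1..j. (- 1) ^ (i - 1) * Q i (j - i) (D_op x F)) = of_nat j * E j (D_op x F)"
      by (simp add: Q_def E_def Cons.IH)
    also have "(\<Sum>i=1..j. if i = j then 0 else (- 1) ^ (i - 1) * Q i (k - i) (D_op (x + s) F)) =
        (\<Sum>i=1..k. (- 1) ^ (i - 1) * Q i (k - i) (D_op (x + s) F))"
      by (rule sum.mono_neutral_cong_right) (auto simp: Suc)
    also have "\<dots> = of_nat k * E k (D_op (x + s) F)"
      by (simp add: Q_def E_def Cons.IH)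
    also have "(\<Sum>i=1..j. if i = j then 0 else - h (Suc i)) = (\<Sum>i=1..k. - h (Suc i))"
      by (rule sum.mono_neutral_cong_right) (auto simp: Suc)
    \<comment> \<open>These terms cancel the sum of all \<open>h i\<close> except
      \<open>h 1\<close>, which is $z_1 e_{j-1}(z')$.\<close>
    also have "\<dots> = - (\<Sum>i=Suc 1..j. h i)"
      unfolding sum_negf Suc sum.shift_bounds_cl_Suc_ivl ..
    also have "(\<Sum>i=1..j. h i) = h 1 + (\<Sum>i=Suc 1..j. h i)"
      by (rule sum.atLeast_Suc_atMost) (simp add: Suc)
    also have "h 1 = E k (D_op (x + s) F)"
      by (simp add: h_def Suc)
    finally show ?thesis
      by (simp add: Suc E_def algebra_simps)
  qed simp
qed

text \<open>Treats both directions at once: multiplication by $p_i$ with \<open>s = 1\<close> and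
  \<partial>/\<partial>p_i with \<open>s = - 1\<close>. That \<kappa> is nonzero allows the shifted
  term to be isolated.\<close>

locale shift_commutator =
  fixes T :: "nat \<Rightarrow> ratqt mps \<Rightarrow> ratqt mps" and \<kappa> :: "nat \<Rightarrow> ratqt" and s :: int
  assumes Lam_T: "F \<in> Lam \<Longrightarrow> T i F \<in> Lam"
    and T_add: "F \<in> Lam \<Longrightarrow> G \<in> Lam \<Longrightarrow> T i (F + G) = T i F + T i G"
    and T_scale: "F \<in> Lam \<Longrightarrow> T i (mps_const x * F) = mps_const x * T i F"
    and \<kappa>_nonzero: "i > 0 \<Longrightarrow> \<kappa> i \<noteq> 0"
    and D_op_T: "F \<in> Lam \<Longrightarrow> i > 0 \<Longrightarrow>
      D_op k (T i F) = T i (D_op k F) + mps_const (\<kappa> i) * D_op (k + s * int i) F"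
begin

lemma T_0: "T i 0 = 0"
  using T_scale[of 0 i 0] by simp

lemma T_sum: "(\<And>x. x \<in> A \<Longrightarrow> f x \<in> Lam) \<Longrightarrow> T i (\<Sum>x\<in>A. f x) = (\<Sum>x\<in>A. T i (f x))"
  by (induction A rule: infinite_finite_induct) (auto simp: T_0 T_add Lam_sum)

text \<open>Moving \<open>T i\<close> past the letters one by one, each letter contributes once with
  its index shifted by a further \<open>s * int i\<close>; summed over the letters this is
  $p_i(z)$.\<close>

lemma elem_shift_T:
  assumes "F \<in> Lam" "i > 0"
  shows "elem_shift s j a (T i F) =
    T i (elem_shift s j a F) + mps_const (\<kappa> i) * psum_elem_shift s i j a F"
  using assms(1)
proof (induction a arbitrary: j F)
  case Nil
  show ?case
    by (simp add: T_0)
next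
  case (Cons x a)
  then show ?case
    using assms(2)
    by (simp add: D_op_T elem_shift_add elem_shift_scale Lam_T T_add T_0)
      (simp add: algebra_simps)
qed

text \<open>
  Commuting with $T_i$ multiplies by $p_i(z)$, so it preserves vanishing; by Newton's identities so
  does multiplication by every $e_j(z)$.
\<close>

lemma elem_shift_vanishes:
  assumes "\<And>F. F \<in> Lam \<Longrightarrow> (\<Sum>x\<in>I. mps_const (\<gamma> x) * D_word (w x) F) = 0" "F \<in> Lam"
  shows "(\<Sum>x\<in>I. mps_const (\<gamma> x) * elem_shift s j (w x) F) = 0"
  using assms(2)
proof (induction j arbitrary: F rule: less_induct)
  case (less j)
  show ?case
  proof (cases "j = 0")
    case True
    then show ?thesis
      using assms(1) less.prems by (simp add: elem_shift_0)
  next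
    case False
    \<comment> \<open>The combination for $e_{j-i}(z)$ vanishes at \<open>F\<close> and at
      \<open>T i F\<close> by induction, as \<open>i\<close> is positive. Commuting
      \<open>T i\<close> through it leaves only the multiple of $p_i(z) e_{j-i}(z)$.\<close>
    have Q: "(\<Sum>x\<in>I. mps_const (\<gamma> x) * psum_elem_shift s i (j - i) (w x) F) = 0" if i: "i \<in> {1..j}" for i
    proof -
      have IH: "(\<Sum>x\<in>I. mps_const (\<gamma> x) * elem_shift s (j - i) (w x) G) = 0" if "G \<in> Lam" for G
        using i by (intro less.IH that) auto
      have "0 = (\<Sum>x\<in>I. mps_const (\<gamma> x) * elem_shift s (j - i) (w x) (T i F))"
        by (simp add: IH Lam_T less.prems)
      also have "\<dots> = (\<Sum>x\<in>I. mps_const (\<gamma> x) * T i (elem_shift s (j - i) (w x) F)) +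
          mps_const (\<kappa> i) * (\<Sum>x\<in>I. mps_const (\<gamma> x) * psum_elem_shift s i (j - i) (w x) F)"
        using i less.prems
        by (simp add: elem_shift_T distrib_left sum.distrib sum_distrib_left mult.left_commute)
      also have "(\<Sum>x\<in>I. mps_const (\<gamma> x) * T i (elem_shift s (j - i) (w x) F)) =
          T i (\<Sum>x\<in>I. mps_const (\<gamma> x) * elem_shift s (j - i) (w x) F)"
        using less.prems by (simp add: T_sum T_scale)
      also have "\<dots> = 0"
        by (simp add: IH less.prems T_0)
      finally show ?thesis
        using \<kappa>_nonzero[of i] i mps_const_mult_eq_0D by auto
    qed
    have "of_nat j * (\<Sum>x\<in>I. mps_const (\<gamma> x) * elem_shift s j (w x) F) =
        (\<Sum>x\<in>I. mps_const (\<gamma> x) * (of_nat j * elem_shift s j (w x) F))"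
      by (simp add: sum_distrib_left mult.left_commute)
    also have "\<dots> = (\<Sum>x\<in>I. \<Sum>i=1..j. (- 1) ^ (i - 1) *
        (mps_const (\<gamma> x) * psum_elem_shift s i (j - i) (w x) F))"
      unfolding elem_shift_newton by (simp add: sum_distrib_left mult.left_commute)
    also have "\<dots> = (\<Sum>i=1..j. (- 1) ^ (i - 1) *
        (\<Sum>x\<in>I. mps_const (\<gamma> x) * psum_elem_shift s i (j - i) (w x) F))"
      by (subst sum.swap) (simp add: sum_distrib_left)
    also have "\<dots> = of_nat j * 0"
      by (simp add: Q)
    finally show ?thesis
      by (rule of_nat_mult_eq_imp) (use False in auto)
  qed
qed

end

section \<open>Nonvanishing of p_r[M] and the two shift directions\<close>

lemma X_power_neq_1:
  assumes "r > 0"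
  shows "[:0, 1:] ^ r \<noteq> (1 :: 'a :: idom poly)"
proof
  assume "[:0, 1:] ^ r = (1 :: 'a poly)"
  then have "degree ([:0, 1:] ^ r :: 'a poly) = 0"
    by simp
  then show False
    using assms by (simp add: degree_power_eq)
qed

lemma p_M_nonzero:
  assumes "r > 0"
  shows "p_M r \<noteq> 0"
proof -
  have Fract_power: "Fract p 1 ^ n = Fract (p ^ n) 1" for p :: "rat poly poly" and n
    by (induction n) (simp_all add: One_fract_def)
  have "t_var ^ r \<noteq> 1"
    using X_power_neq_1[OF assms, where 'a = "rat poly"] by (simp add: t_var_def Fract_power One_fract_def eq_fract)
  moreover have "q_var ^ r \<noteq> 1"
  proof
    assume "q_var ^ r = 1"
    then have "[:[:0, 1:]:] ^ r = (1 :: rat poly poly)"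
      by (simp add: q_var_def Fract_power One_fract_def eq_fract)
    \<comment> \<open>Setting $t = 0$ turns $q$, a constant polynomial in $t$, into the variable of
      the inner polynomial ring, where degrees apply.\<close>
    then have "poly ([:[:0, 1:]:] ^ r) 0 = poly (1 :: rat poly poly) 0"
      by simp
    then show False
      using X_power_neq_1[OF assms, where 'a = rat] by (simp add: poly_power)
  qed
  ultimately show ?thesis
    by (simp add: p_M_def)
qed

interpretation up: shift_commutator "\<lambda>i F. psum i * F" p_M 1
  by unfold_locales
    (simp_all add: distrib_left mult.left_commute[of "psum _"] p_M_nonzero D_op_psum_mult)

interpretation down: shift_commutator psum_deriv "\<lambda>i. 1 / of_nat i" "- 1"
  by unfold_locales (simp_all add: psum_deriv_add psum_deriv_scale D_op_psum_deriv)

section \<open>Undoing the shift and descending on the word length\<close>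

lemma word_op_vanishes_if_shifted:
  assumes len: "\<And>a. a \<in> Poly_Mapping.keys c \<Longrightarrow> length a = k"
    and "\<And>F. F \<in> Lam \<Longrightarrow> shifted_word_op c F = 0" "F \<in> Lam"
  shows "word_op c F = 0"
proof -
  \<comment> \<open>On words of length \<open>k\<close>, $e_k(z^{-1})$ lowers every index by one and
    so undoes the shift.\<close>
  have "(\<Sum>a\<in>Poly_Mapping.keys c. mps_const (Poly_Mapping.lookup c a) *
      elem_shift (- 1) k (map (\<lambda>j. j + 1) a) F) = 0"
    by (rule down.elem_shift_vanishes) (use assms in \<open>simp_all add: shifted_word_op_def\<close>)
  also have "(\<Sum>a\<in>Poly_Mapping.keys c. mps_const (Poly_Mapping.lookup c a) *
      elem_shift (- 1) k (map (\<lambda>j. j + 1) a) F) = word_op c F"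
    unfolding word_op_def
  proof (rule sum.cong[OF refl])
    fix a assume "a \<in> Poly_Mapping.keys c"
    then show "mps_const (Poly_Mapping.lookup c a) * elem_shift (- 1) k (map (\<lambda>j. j + 1) a) F =
        mps_const (Poly_Mapping.lookup c a) * D_word a F"
      using elem_shift_length[of "- 1" "map (\<lambda>j. j + 1) a" F] len by (simp add: comp_def)
  qed
  finally show ?thesis .
qed

text \<open>Under $e_m(z)$ the words shorter than \<open>m\<close> are annihilated, while in those
  of length \<open>m\<close> every index is raised by one.\<close>

lemma top_shifted_word_op_vanishes:
  assumes len: "\<And>k a. k \<in> {1..m} \<Longrightarrow> a \<in> Poly_Mapping.keys (c k) \<Longrightarrow> length a = k"
    and van: "\<And>F. F \<in> Lam \<Longrightarrow> (\<Sum>k=1..m. word_op (c k) F) = 0" and "F \<in> Lam" "m > 0"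
  shows "shifted_word_op (c m) F = 0"
proof -
  \<comment> \<open>Pairs of a length and a word turn the double sum into the single family that
    \<open>up.elem_shift_vanishes\<close> takes.\<close>
  let ?I = "SIGMA k:{1..m}. Poly_Mapping.keys (c k)"
  have conv: "(\<Sum>(k, a)\<in>?I. mps_const (Poly_Mapping.lookup (c k) a) * f a) =
      (\<Sum>k=1..m. \<Sum>a\<in>Poly_Mapping.keys (c k). mps_const (Poly_Mapping.lookup (c k) a) * f a)"
    for f :: "int list \<Rightarrow> ratqt mps"
    by (subst sum.Sigma) auto
  have "0 = (\<Sum>p\<in>?I. mps_const (Poly_Mapping.lookup (c (fst p)) (snd p)) * elem_shift 1 m (snd p) F)"
    using van conv[of "\<lambda>a. D_word a _"] \<open>F \<in> Lam\<close>
    by (intro up.elem_shift_vanishes[symmetric]) (simp_all add: word_op_def case_prod_unfold)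
  also have "\<dots> = (\<Sum>k=1..m. \<Sum>a\<in>Poly_Mapping.keys (c k).
      mps_const (Poly_Mapping.lookup (c k) a) * elem_shift 1 m a F)"
    using conv[of "\<lambda>a. elem_shift 1 m a F"] by (simp add: case_prod_unfold)
  also have "\<dots> = (\<Sum>k=1..m. if k = m then shifted_word_op (c k) F else 0)"
  proof (rule sum.cong[OF refl])
    fix k assume k: "k \<in> {1..m}"
    have "elem_shift 1 m a F = (if k = m then D_word (map (\<lambda>j. j + 1) a) F else 0)"
      if "a \<in> Poly_Mapping.keys (c k)" for a
      using len[OF k that] k elem_shift_length[of 1 a F] by (auto simp: elem_shift_eq_0)
    then show "(\<Sum>a\<in>Poly_Mapping.keys (c k). mps_const (Poly_Mapping.lookup (c k) a) *
        elem_shift 1 m a F) = (if k = m then shifted_word_op (c k) F else 0)"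
      by (simp add: shifted_word_op_def)
  qed
  also have "\<dots> = shifted_word_op (c m) F"
    using \<open>m > 0\<close> by simp
  finally show ?thesis
    by simp
qed

text \<open>Once the top shifted combination vanishes, undoing the shift makes the top combination
  itself vanish; it can be removed from the sum, which leaves shorter words.\<close>

lemma shifted_word_ops_vanish:
  assumes "\<And>k a. k \<in> {1..m} \<Longrightarrow> a \<in> Poly_Mapping.keys (c k) \<Longrightarrow> length a = k"
    and "\<And>F. F \<in> Lam \<Longrightarrow> (\<Sum>k=1..m. word_op (c k) F) = 0" "k \<in> {1..m}" "F \<in> Lam"
  shows "shifted_word_op (c k) F = 0"
  using assms
proof (induction m arbitrary: k F)
  case (Suc m)
  have top: "shifted_word_op (c (Suc m)) G = 0" if "G \<in> Lam" for G
    using Suc.prems(1,2) that by (rule top_shifted_word_op_vanishes) auto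
  have "word_op (c (Suc m)) G = 0" if "G \<in> Lam" for G
    using Suc.prems(1)[of "Suc m"] top that by (intro word_op_vanishes_if_shifted[of _ "Suc m"]) auto
  then have rest: "(\<Sum>k=1..m. word_op (c k) G) = 0" if "G \<in> Lam" for G
    using Suc.prems(2)[OF that] that by simp
  show ?case
  proof (cases "k = Suc m")
    case False
    show ?thesis
      using Suc.prems False rest by (intro Suc.IH) auto
  qed (use top Suc.prems in simp)
qed simp

theorem theorem2p2:
  fixes m :: nat and c :: "nat \<Rightarrow> (int list \<Rightarrow>\<^sub>0 ratqt)"
  assumes "\<And>k a. k \<in> {1..m} \<Longrightarrow> a \<in> Poly_Mapping.keys (c k) \<Longrightarrow> length a = k"
  shows "(\<forall>F\<in>Lam. (\<Sum>k=1..m. word_op (c k) F) = 0) \<longleftrightarrow>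
         (\<forall>k\<in>{1..m}. \<forall>F\<in>Lam. shifted_word_op (c k) F = 0)"
proof
  assume "\<forall>F\<in>Lam. (\<Sum>k=1..m. word_op (c k) F) = 0"
  then show "\<forall>k\<in>{1..m}. \<forall>F\<in>Lam. shifted_word_op (c k) F = 0"
    using shifted_word_ops_vanish[of m c] assms by blast
next
  assume "\<forall>k\<in>{1..m}. \<forall>F\<in>Lam. shifted_word_op (c k) F = 0"
  \<comment> \<open>All words of \<open>c k\<close> have length \<open>k\<close>, so each summand is
    unshifted by itself.\<close>
  then have "word_op (c k) F = 0" if "k \<in> {1..m}" "F \<in> Lam" for k F
    using word_op_vanishes_if_shifted[of "c k" k] assms that by blast
  then show "\<forall>F\<in>Lam. (\<Sum>k=1..m. word_op (c k) F) = 0"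
    by simp
qed

end
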